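(* Let $(X,\mathcal E)$ be an infinite locally finite connected graph with symmetric edge weights $\mu_{xy}=\mu_{yx}>0$, and assume that $\lambda_1(X)>0$. Then $X$ has a global Green function.
   Context: A locally finite connected graph $(X,\mathcal E)$ is a simple (no loops, no multiple edges), connected graph with countable vertex set $X$ and edge set $\mathcal E$ in which each vertex has finitely many neighbors. It carries a symmetric weight $\mu_{xy}=\mu_{yx}>0$ on $\mathcal E$, and $d_x=\sum_{y:(x,y)\in\mathcal E}\mu_{xy}<\infty$ is the degree of $x$. For $u:X\to\mathbb R$, $(\Delta u)(x)=\sum_{y:(x,y)\in\mathcal E}\frac{\mu_{xy}}{d_x}(u(y)-u(x))$. Integrals are $\int_Du=\sum_{x\in D}u(x)d_x$. For a finite set $D\subset X$, $\delta D$ is the set of vertices not in $D$ adjacent to some vertex of $D$, and $$\lambda_1(D)=\inf\left\{\frac{\int_D(-\Delta u)u}{\int_Du^2}:\ u:D\cup\delta D\to\mathbb R,\ u\not\equiv0,\ u|_{\delta D}=0\right\}.$$ For an exhaustion $\{D_j\}$ of $X$ (an increasing sequence of finite sets with $\bigcup_jD_j=X$), $\lambda_1(X)=\lim_j\lambda_1(D_j)$, which does not depend on the exhaustion. Let $p(x,y)=\mu_{xy}/d_x$ if $(x,y)\in\mathcal E$ and $0$ otherwise, $Pf(x)=\sum_yp(x,y)f(y)$ (so $\Delta=P-I$), and let $p_n(x,y)$ be the matrix entries of $P^n$ ($P^0=I$). $X$ has a global Green function if $\sum_{n\ge0}p_n(x,y)<\infty$ for all $x,y\in X$; the Green function is then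 $G(x,y)=\sum_{n\ge0}p_n(x,y)$. Equivalently, the Dirichlet Green functions of an exhaustion of $X$ by finite sets (same construction with $P$ restricted to the finite set) have finite limit $G(x,y)$. *)

theory Defs
  imports "HOL-Library.Countable_Set" Complex_Main
begin

text \<open>Edges are a symmetric irreflexive set of ordered pairs over the vertex set \<open>X\<close>;
  the weight \<open>\<mu>\<close> is only constrained (and only used) on edges.\<close>

locale weighted_graph =
  fixes X :: "'a set" and E :: "('a \<times> 'a) set" and \<mu> :: "'a \<Rightarrow> 'a \<Rightarrow> real"
  assumes countable_verts: "countable X"
    and edges_subset: "E \<subseteq> X \<times> X"
    and sym_edges: "sym E"
    and no_loops: "irrefl E"
    and locally_finite: "\<And>x. x \<in> X \<Longrightarrow> finite {y. (x, y) \<in> E}"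
    and connected: "\<And>x y. x \<in> X \<Longrightarrow> y \<in> X \<Longrightarrow> (x, y) \<in> E\<^sup>*"
    and weight_sym: "\<And>x y. (x, y) \<in> E \<Longrightarrow> \<mu> x y = \<mu> y x"
    and weight_pos: "\<And>x y. (x, y) \<in> E \<Longrightarrow> \<mu> x y > 0"

definition deg :: "('a \<times> 'a) set \<Rightarrow> ('a \<Rightarrow> 'a \<Rightarrow> real) \<Rightarrow> 'a \<Rightarrow> real" where
  "deg E \<mu> x = (\<Sum>y | (x, y) \<in> E. \<mu> x y)"

definition laplacian ::
  "('a \<times> 'a) set \<Rightarrow> ('a \<Rightarrow> 'a \<Rightarrow> real) \<Rightarrow> ('a \<Rightarrow> real) \<Rightarrow> 'a \<Rightarrow> real" where
  "laplacian E \<mu> u x = (\<Sum>y | (x, y) \<in> E. \<mu> x y / deg E \<mu> x * (u y - u x))"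

definition graph_integral ::
  "('a \<times> 'a) set \<Rightarrow> ('a \<Rightarrow> 'a \<Rightarrow> real) \<Rightarrow> 'a set \<Rightarrow> ('a \<Rightarrow> real) \<Rightarrow> real" where
  "graph_integral E \<mu> D u = (\<Sum>x\<in>D. u x * deg E \<mu> x)"

definition boundary :: "'a set \<Rightarrow> ('a \<times> 'a) set \<Rightarrow> 'a set \<Rightarrow> 'a set" where
  "boundary X E D = {y \<in> X - D. \<exists>x\<in>D. (x, y) \<in> E}"

text \<open>The functions \<open>u\<close> below are total, but only their values on \<open>D \<union> boundary X E D\<close>
  matter: every neighbour of a vertex of \<open>D\<close> lies in this set. The infimum is meaningful
  for \<open>D \<noteq> {}\<close>; the terms of an exhaustion of a nonempty graph are eventually nonempty.\<close>

definition lambda1 ::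
  "'a set \<Rightarrow> ('a \<times> 'a) set \<Rightarrow> ('a \<Rightarrow> 'a \<Rightarrow> real) \<Rightarrow> 'a set \<Rightarrow> real" where
  "lambda1 X E \<mu> D =
     Inf {graph_integral E \<mu> D (\<lambda>x. - laplacian E \<mu> u x * u x)
            / graph_integral E \<mu> D (\<lambda>x. (u x)\<^sup>2) | u.
          (\<exists>x \<in> D \<union> boundary X E D. u x \<noteq> 0) \<and> (\<forall>x \<in> boundary X E D. u x = 0)}"

definition exhaustion :: "'a set \<Rightarrow> (nat \<Rightarrow> 'a set) \<Rightarrow> bool" where
  "exhaustion X D \<longleftrightarrow> incseq D \<and> (\<forall>j. finite (D j)) \<and> (\<Union>j. D j) = X"

text \<open>The common limit along all exhaustions; existence and uniqueness are proved in
  \<open>lambda1_graph_well_defined\<close> and \<open>lambda1_graph_limit\<close>.\<close>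

definition lambda1_graph ::
  "'a set \<Rightarrow> ('a \<times> 'a) set \<Rightarrow> ('a \<Rightarrow> 'a \<Rightarrow> real) \<Rightarrow> real" where
  "lambda1_graph X E \<mu> =
     (THE l. \<forall>D. exhaustion X D \<longrightarrow> (\<lambda>j. lambda1 X E \<mu> (D j)) \<longlonglongrightarrow> l)"

definition trans_prob ::
  "('a \<times> 'a) set \<Rightarrow> ('a \<Rightarrow> 'a \<Rightarrow> real) \<Rightarrow> 'a \<Rightarrow> 'a \<Rightarrow> real" where
  "trans_prob E \<mu> x y = (if (x, y) \<in> E then \<mu> x y / deg E \<mu> x else 0)"

text \<open>The sum over all \<open>y\<close> reduces to the finitely many \<open>y\<close> with \<open>p(x, y) \<noteq> 0\<close>.\<close>

definition trans_op ::
  "('a \<times> 'a) set \<Rightarrow> ('a \<Rightarrow> 'a \<Rightarrow> real) \<Rightarrow> ('a \<Rightarrow> real) \<Rightarrow> 'a \<Rightarrow> real" where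
  "trans_op E \<mu> f x = (\<Sum>y | (x, y) \<in> E. trans_prob E \<mu> x y * f y)"

text \<open>The \<open>(x, y)\<close> matrix entry of \<open>P\<^sup>n\<close> is \<open>P\<^sup>n\<close> applied to the point mass at \<open>y\<close>,
  evaluated at \<open>x\<close>.\<close>

definition trans_prob_n ::
  "('a \<times> 'a) set \<Rightarrow> ('a \<Rightarrow> 'a \<Rightarrow> real) \<Rightarrow> nat \<Rightarrow> 'a \<Rightarrow> 'a \<Rightarrow> real" where
  "trans_prob_n E \<mu> n x y = (trans_op E \<mu> ^^ n) (\<lambda>z. if z = y then 1 else 0) x"

definition has_global_Green ::
  "'a set \<Rightarrow> ('a \<times> 'a) set \<Rightarrow> ('a \<Rightarrow> 'a \<Rightarrow> real) \<Rightarrow> bool" where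
  "has_global_Green X E \<mu> \<longleftrightarrow> (\<forall>x\<in>X. \<forall>y\<in>X. summable (\<lambda>n. trans_prob_n E \<mu> n x y))"

context weighted_graph
begin

lemma deg_nonneg: "0 \<le> deg E \<mu> x"
  unfolding deg_def by (intro sum_nonneg) (auto intro: less_imp_le weight_pos)

lemma deg_pos: 
  assumes "x \<in> X" "(x, y) \<in> E" shows "0 < deg E \<mu> x"
  unfolding deg_def
  by (rule sum_pos2[of _ y]) (use assms locally_finite in \<open>auto intro: less_imp_le weight_pos\<close>)

lemma energy_eq:
  assumes "x \<in> X"
  shows "- laplacian E \<mu> u x * u x * deg E \<mu> x
       = (\<Sum>y | (x, y) \<in> E. \<mu> x y * (u x - u y) * u x)"
proof (cases "{y. (x, y) \<in> E} = {}")
  case True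
  then show ?thesis by (simp add: deg_def laplacian_def)
next
  case False
  then have d: "deg E \<mu> x > 0" using deg_pos assms by blast
  have "- laplacian E \<mu> u x * u x * deg E \<mu> x
      = (\<Sum>y | (x, y) \<in> E. - (\<mu> x y / deg E \<mu> x * (u y - u x)) * u x * deg E \<mu> x)"
    unfolding laplacian_def by (simp add: sum_distrib_right sum_negf)
  also have "\<dots> = (\<Sum>y | (x, y) \<in> E. \<mu> x y * (u x - u y) * u x)"
    using d by (intro sum.cong) (auto simp: field_simps)
  finally show ?thesis .
qed

lemma energy_nonneg:
  assumes "finite D" "D \<subseteq> X" and bd: "\<forall>x \<in> boundary X E D. u x = 0"
  shows "0 \<le> graph_integral E \<mu> D (\<lambda>x. - laplacian E \<mu> u x * u x)"
proof -
  define w where "w = (\<lambda>x y. if (x, y) \<in> E then \<mu> x y else 0)"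
  have wsym: "w x y = w y x" for x y
    using weight_sym sym_edges by (auto simp: w_def sym_def)
  have w0: "0 \<le> w x y" for x y
    by (auto simp: w_def intro: less_imp_le weight_pos)
  have split: "(\<Sum>y\<in>D. w x y * (u x - u y) * u x)
      \<le> - laplacian E \<mu> u x * u x * deg E \<mu> x" if x: "x \<in> D" for x
  proof -
    have xX: "x \<in> X" using x assms by auto
    have fin: "finite {y. (x, y) \<in> E}" using locally_finite xX by blast
    have "(\<Sum>y\<in>D. w x y * (u x - u y) * u x)
        = (\<Sum>y\<in>D \<inter> {y. (x, y) \<in> E}. \<mu> x y * (u x - u y) * u x)"
      unfolding w_def using assms(1)
      by (intro sum.mono_neutral_cong_right) auto
    also have "\<dots> \<le> (\<Sum>y | (x, y) \<in> E. \<mu> x y * (u x - u y) * u x)"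
    proof (rule sum_mono2[OF fin])
      fix y assume y: "y \<in> {y. (x, y) \<in> E} - D \<inter> {y. (x, y) \<in> E}"
      then have "y \<in> boundary X E D" using x edges_subset by (auto simp: boundary_def)
      then have "u y = 0" using bd by blast
      then show "0 \<le> \<mu> x y * (u x - u y) * u x"
        using weight_pos[of x y] y by (simp add: mult.assoc)
    qed auto
    finally show ?thesis by (simp only: energy_eq[OF xX])
  qed
  have "(\<Sum>x\<in>D. \<Sum>y\<in>D. w x y * (u x - u y) * u x)
      = (\<Sum>x\<in>D. \<Sum>y\<in>D. w x y * (u y - u x) * u y)"
    by (subst sum.swap) (simp add: wsym)
  then have "2 * (\<Sum>x\<in>D. \<Sum>y\<in>D. w x y * (u x - u y) * u x)
      = (\<Sum>x\<in>D. \<Sum>y\<in>D. w x y * (u x - u y) * u x + w x y * (u y - u x) * u y)"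
    by (simp add: sum.distrib)
  also have "\<dots> = (\<Sum>x\<in>D. \<Sum>y\<in>D. w x y * (u x - u y)\<^sup>2)"
    by (simp add: power2_eq_square algebra_simps)
  also have "\<dots> \<ge> 0" by (intro sum_nonneg mult_nonneg_nonneg w0) auto
  finally have "0 \<le> (\<Sum>x\<in>D. \<Sum>y\<in>D. w x y * (u x - u y) * u x)" by simp
  also have "\<dots> \<le> graph_integral E \<mu> D (\<lambda>x. - laplacian E \<mu> u x * u x)"
    unfolding graph_integral_def by (intro sum_mono split)
  finally show ?thesis .
qed

definition admissible :: "'a set \<Rightarrow> ('a \<Rightarrow> real) \<Rightarrow> bool" where
  "admissible D u \<longleftrightarrow>
     (\<exists>x \<in> D \<union> boundary X E D. u x \<noteq> 0) \<and> (\<forall>x \<in> boundary X E D. u x = 0)"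

definition rayleigh :: "'a set \<Rightarrow> ('a \<Rightarrow> real) \<Rightarrow> real" where
  "rayleigh D u = graph_integral E \<mu> D (\<lambda>x. - laplacian E \<mu> u x * u x)
            / graph_integral E \<mu> D (\<lambda>x. (u x)\<^sup>2)"

lemma lambda1_alt: "lambda1 X E \<mu> D = Inf {rayleigh D u | u. admissible D u}"
  by (simp add: lambda1_def rayleigh_def admissible_def)

lemma rayleigh_nonneg:
  assumes "finite D" "D \<subseteq> X" "admissible D u" shows "0 \<le> rayleigh D u"
proof -
  have "0 \<le> graph_integral E \<mu> D (\<lambda>x. (u x)\<^sup>2)"
    unfolding graph_integral_def by (intro sum_nonneg mult_nonneg_nonneg deg_nonneg) auto
  then show ?thesis
    using energy_nonneg[OF assms(1,2)] assms(3)
    by (auto simp: rayleigh_def admissible_def)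
qed

lemma rayleigh_set_nonempty:
  assumes "D \<noteq> {}" shows "{rayleigh D u | u. admissible D u} \<noteq> {}"
proof -
  have "admissible D (\<lambda>x. if x \<in> D then 1 else 0)"
    using assms by (auto simp: admissible_def boundary_def)
  then show ?thesis by blast
qed

lemma rayleigh_extend:
  assumes "finite D'" "D \<subseteq> D'" "D' \<subseteq> X" "admissible D u"
  shows "\<exists>v. admissible D' v \<and> rayleigh D' v = rayleigh D u"
proof -
  define v where "v = (\<lambda>x. if x \<in> D then u x else 0)"
  have "\<exists>x\<in>D. u x \<noteq> 0" using assms(4) by (auto simp: admissible_def)
  then have adm: "admissible D' v"
    using assms(2) by (auto simp: admissible_def v_def boundary_def)
  have lap: "laplacian E \<mu> v x = laplacian E \<mu> u x" if x: "x \<in> D" for x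
  proof -
    have "v y = u y" if "(x, y) \<in> E" for y
    proof (cases "y \<in> D")
      case False
      then have "y \<in> boundary X E D" using that x edges_subset by (auto simp: boundary_def)
      then show ?thesis using assms(4) False by (auto simp: admissible_def v_def)
    qed (simp add: v_def)
    then show ?thesis using x by (simp add: laplacian_def v_def)
  qed
  have 1: "graph_integral E \<mu> D' (\<lambda>x. - laplacian E \<mu> v x * v x)
      = graph_integral E \<mu> D (\<lambda>x. - laplacian E \<mu> u x * u x)"
    unfolding graph_integral_def using assms(1,2)
    by (intro sum.mono_neutral_cong_right) (auto simp: lap, auto simp: v_def)
  have 2: "graph_integral E \<mu> D' (\<lambda>x. (v x)\<^sup>2) = graph_integral E \<mu> D (\<lambda>x. (u x)\<^sup>2)"
    unfolding graph_integral_def using assms(1,2)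
    by (intro sum.mono_neutral_cong_right) (auto simp: v_def)
  show ?thesis using adm 1 2 by (auto simp: rayleigh_def)
qed

lemma lambda1_nonneg:
  assumes "finite D" "D \<subseteq> X" "D \<noteq> {}" shows "0 \<le> lambda1 X E \<mu> D"
  unfolding lambda1_alt
  using rayleigh_set_nonempty[OF assms(3)] rayleigh_nonneg[OF assms(1,2)]
  by (intro cInf_greatest) auto

lemma lambda1_antimono:
  assumes "finite D'" "D \<subseteq> D'" "D' \<subseteq> X" "D \<noteq> {}"
  shows "lambda1 X E \<mu> D' \<le> lambda1 X E \<mu> D"
  unfolding lambda1_alt
proof (rule cInf_superset_mono)
  show "{rayleigh D u | u. admissible D u} \<noteq> {}" by (rule rayleigh_set_nonempty) fact
  show "bdd_below {rayleigh D' u | u. admissible D' u}"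
    using rayleigh_nonneg[OF assms(1,3)] by (intro bdd_belowI[of _ 0]) auto
  show "{rayleigh D u | u. admissible D u} \<subseteq> {rayleigh D' u | u. admissible D' u}"
  proof
    fix r assume "r \<in> {rayleigh D u | u. admissible D u}"
    then obtain u where "r = rayleigh D u" "admissible D u" by blast
    with rayleigh_extend[OF assms(1,2,3), of u]
    obtain v where "admissible D' v" "r = rayleigh D' v" by auto
    then show "r \<in> {rayleigh D' u | u. admissible D' u}" by blast
  qed
qed

lemma exhaustion_exists: "\<exists>D. exhaustion X D"
proof (cases "X = {}")
  case True
  then show ?thesis by (intro exI[of _ "\<lambda>_. {}"]) (auto simp: exhaustion_def)
next
  case False
  have "(\<Union>j. from_nat_into X ` {..<j}) = range (from_nat_into X)" by auto
  also have "\<dots> = X" using range_from_nat_into[OF False countable_verts] .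
  finally have "exhaustion X (\<lambda>j. from_nat_into X ` {..<j})"
    by (auto simp: exhaustion_def intro!: incseq_SucI)
  then show ?thesis by blast
qed

lemma exhaustion_eventually_contains:
  assumes "exhaustion X D" "finite F" "F \<subseteq> X"
  shows "\<exists>N. \<forall>j\<ge>N. F \<subseteq> D j"
  using assms(2,3)
proof (induction F)
  case (insert x F)
  then obtain N where N: "\<forall>j\<ge>N. F \<subseteq> D j" by auto
  from insert assms(1) obtain M where "x \<in> D M" by (auto simp: exhaustion_def)
  then have "\<forall>j\<ge>M. x \<in> D j" using assms(1) by (auto simp: exhaustion_def incseq_def)
  then show ?case using N by (intro exI[of _ "max M N"]) auto
qed auto

lemma lambda1_exhaustion_limit:
  assumes "exhaustion X D" "X \<noteq> {}"
  shows "(\<lambda>j. lambda1 X E \<mu> (D j)) \<longlonglongrightarrow> Inf (lambda1 X E \<mu> ` {F. finite F \<and> F \<noteq> {} \<and> F \<subseteq> X})"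
    (is "_ \<longlonglongrightarrow> Inf ?S")
proof (rule LIMSEQ_I)
  fix e :: real assume "0 < e"
  have ne: "?S \<noteq> {}" using assms(2) by (auto intro!: exI[of _ "{SOME x. x \<in> X}"] some_in_eq[THEN iffD2])
  have bdd: "bdd_below ?S" by (intro bdd_belowI[of _ 0]) (auto intro: lambda1_nonneg)
  from \<open>0 < e\<close> have "Inf ?S < Inf ?S + e" by simp
  then obtain F where F: "finite F" "F \<noteq> {}" "F \<subseteq> X" "lambda1 X E \<mu> F < Inf ?S + e"
    using cInf_lessD[OF ne, of "Inf ?S + e"] by blast
  obtain N where N: "\<forall>j\<ge>N. F \<subseteq> D j"
    using exhaustion_eventually_contains[OF assms(1) F(1,3)] by blast
  show "\<exists>N. \<forall>j\<ge>N. norm (lambda1 X E \<mu> (D j) - Inf ?S) < e"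
  proof (intro exI[of _ N] allI impI)
    fix j assume "j \<ge> N"
    then have FD: "F \<subseteq> D j" using N by blast
    have Dj: "finite (D j)" "D j \<subseteq> X" using assms(1) by (auto simp: exhaustion_def)
    have "lambda1 X E \<mu> (D j) \<le> lambda1 X E \<mu> F"
      by (rule lambda1_antimono) (use FD Dj F in auto)
    moreover have "Inf ?S \<le> lambda1 X E \<mu> (D j)"
      by (rule cInf_lower[OF _ bdd]) (use FD Dj F in auto)
    ultimately show "norm (lambda1 X E \<mu> (D j) - Inf ?S) < e" using F(4) by simp
  qed
qed

lemma lambda1_graph_well_defined:
  assumes "X \<noteq> {}"
  shows "\<exists>!l. \<forall>D. exhaustion X D \<longrightarrow> (\<lambda>j. lambda1 X E \<mu> (D j)) \<longlonglongrightarrow> l"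
  using exhaustion_exists lambda1_exhaustion_limit[OF _ assms]
  by (meson LIMSEQ_unique)

lemma lambda1_graph_limit:
  assumes "X \<noteq> {}" "exhaustion X D"
  shows "(\<lambda>j. lambda1 X E \<mu> (D j)) \<longlonglongrightarrow> lambda1_graph X E \<mu>"
  unfolding lambda1_graph_def
  using theI'[OF lambda1_graph_well_defined[OF assms(1)]] assms(2) by blast

end

end

(* For the partial sums S of the Green function with pole y, S - P S is at most the point mass
   at y. Pairing with S in l^2(deg) and using the spectral gap l > 0 gives
   l * |S|^2 <= S(y) * deg y. Since S(y)^2 * deg y <= |S|^2, this bounds S(y) by 1 / l, hence |S|,
   and with it S(x) for every x, uniformly in the number of terms. *)

theory Submission imports Defs begin

context weighted_graph
begin

text \<open>A path from \<open>x\<close> to any second vertex starts with an edge at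
  \<open>x\<close>, so \<open>x\<close> is not isolated. All later divisions by the degree rest on
  this.\<close>

lemma deg_pos_of_infinite:
  assumes "infinite X" "x \<in> X" shows "0 < deg E \<mu> x"
proof -
  obtain z where z: "z \<in> X" "z \<noteq> x"
    using assms by (metis finite.emptyI finite_insert finite_subset insertI1 subsetI)
  then obtain y where "(x, y) \<in> E"
    using connected[OF assms(2) z(1)] by (metis converse_rtranclE)
  then show ?thesis using deg_pos assms(2) by blast
qed

lemma laplacian_eq_trans_op:
  assumes "0 < deg E \<mu> x" shows "laplacian E \<mu> u x = trans_op E \<mu> u x - u x"
proof -
  have "(\<Sum>y | (x, y) \<in> E. \<mu> x y / deg E \<mu> x) = 1"
    using assms by (simp add: sum_divide_distrib[symmetric] flip: deg_def)
  \<comment> \<open>Summed with the constant factor \<open>u x\<close>, this turns the subtracted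
    part of the Laplacian into \<open>u x\<close> itself.\<close>
  then have "(\<Sum>y | (x, y) \<in> E. \<mu> x y / deg E \<mu> x * u x) = u x"
    by (metis mult_1 sum_distrib_right)
  then show ?thesis
    unfolding laplacian_def trans_op_def trans_prob_def
    by (simp only: right_diff_distrib sum_subtractf) (auto intro: sum.cong)
qed

lemma trans_op_nonneg:
  assumes "\<And>y. 0 \<le> f y" shows "0 \<le> trans_op E \<mu> f x"
  unfolding trans_op_def trans_prob_def
  by (intro sum_nonneg mult_nonneg_nonneg assms)
    (auto intro: divide_nonneg_nonneg deg_nonneg less_imp_le[OF weight_pos])

lemma trans_op_sum: "trans_op E \<mu> (\<lambda>x. \<Sum>i\<in>I. f i x) x = (\<Sum>i\<in>I. trans_op E \<mu> (f i) x)"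
  unfolding trans_op_def by (simp add: sum_distrib_left) (rule sum.swap)

text \<open>Since \<open>E\<close> is symmetric, the support of \<open>trans_op E \<mu> f\<close>
  lies among the neighbours of the support of \<open>f\<close>, and local finiteness keeps this set
  finite. By iteration, Green partial sums have finite support and can serve as test functions for
  Rayleigh quotients.\<close>

lemma trans_op_finite_support:
  assumes "finite {x. f x \<noteq> 0}" "{x. f x \<noteq> 0} \<subseteq> X"
  shows "finite {x. trans_op E \<mu> f x \<noteq> 0}" "{x. trans_op E \<mu> f x \<noteq> 0} \<subseteq> X"
proof -
  have "{x. trans_op E \<mu> f x \<noteq> 0} \<subseteq> (\<Union>y\<in>{y. f y \<noteq> 0}. {x. (y, x) \<in> E})"
  proof
    fix x assume "x \<in> {x. trans_op E \<mu> f x \<noteq> 0}"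
    then obtain y where "(x, y) \<in> E" "f y \<noteq> 0"
      unfolding trans_op_def mem_Collect_eq
      by (metis (no_types, lifting) mem_Collect_eq mult_zero_right sum.neutral)
    then show "x \<in> (\<Union>y\<in>{y. f y \<noteq> 0}. {x. (y, x) \<in> E})"
      using sym_edges by (auto simp: sym_def)
  qed
  moreover have "finite (\<Union>y\<in>{y. f y \<noteq> 0}. {x. (y, x) \<in> E})"
    using assms locally_finite by auto
  moreover have "(\<Union>y\<in>{y. f y \<noteq> 0}. {x. (y, x) \<in> E}) \<subseteq> X"
    using edges_subset by auto
  ultimately show "finite {x. trans_op E \<mu> f x \<noteq> 0}" "{x. trans_op E \<mu> f x \<noteq> 0} \<subseteq> X"
    by (auto intro: finite_subset)
qed

lemma trans_prob_n_0: "trans_prob_n E \<mu> 0 x y = (if x = y then 1 else 0)"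
  by (simp add: trans_prob_n_def)

lemma trans_prob_n_Suc:
  "trans_prob_n E \<mu> (Suc n) x y = trans_op E \<mu> (\<lambda>z. trans_prob_n E \<mu> n z y) x"
  by (simp add: trans_prob_n_def)

lemma trans_prob_n_nonneg: "0 \<le> trans_prob_n E \<mu> n x y"
  by (induction n arbitrary: x) (simp_all add: trans_prob_n_0 trans_prob_n_Suc trans_op_nonneg)

lemma trans_prob_n_finite_support:
  assumes "y \<in> X"
  shows "finite {x. trans_prob_n E \<mu> n x y \<noteq> 0}" "{x. trans_prob_n E \<mu> n x y \<noteq> 0} \<subseteq> X"
proof (induction n)
  case 0
  show "finite {x. trans_prob_n E \<mu> 0 x y \<noteq> 0}" "{x. trans_prob_n E \<mu> 0 x y \<noteq> 0} \<subseteq> X"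
    using assms by (auto simp: trans_prob_n_0)
next
  case (Suc n)
  show "finite {x. trans_prob_n E \<mu> (Suc n) x y \<noteq> 0}"
    "{x. trans_prob_n E \<mu> (Suc n) x y \<noteq> 0} \<subseteq> X"
    unfolding trans_prob_n_Suc by (rule trans_op_finite_support[OF Suc])+
qed

text \<open>Each \<open>D\<close> is eventually contained in the sets of an exhaustion, and
  \<open>lambda1\<close> can only drop as the set grows, so the limit lies below every
  \<open>lambda1 X E \<mu> D\<close>.\<close>

lemma lambda1_graph_le:
  assumes "finite D" "D \<noteq> {}" "D \<subseteq> X"
  shows "lambda1_graph X E \<mu> \<le> lambda1 X E \<mu> D"
proof -
  have ne: "X \<noteq> {}" using assms by auto
  obtain F where F: "exhaustion X F" using exhaustion_exists by blast
  obtain N where N: "\<forall>j\<ge>N. D \<subseteq> F j"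
    using exhaustion_eventually_contains[OF F assms(1,3)] by blast
  show ?thesis
  proof (rule LIMSEQ_le_const2[OF lambda1_graph_limit[OF ne F]], intro exI[of _ N] allI impI)
    fix j assume "j \<ge> N"
    then show "lambda1 X E \<mu> (F j) \<le> lambda1 X E \<mu> D"
      using N F assms by (intro lambda1_antimono) (auto simp: exhaustion_def)
  qed
qed

text \<open>This is the Rayleigh bound with the denominator cleared and the Laplacian written as P -
  I. Vanishing off \<open>D\<close> gives the zero boundary values that admissibility asks
  for.\<close>

lemma spectral_gap:
  assumes inf: "infinite X" and D: "finite D" "D \<subseteq> X" and supp: "\<And>x. x \<notin> D \<Longrightarrow> u x = 0"
  shows "lambda1_graph X E \<mu> * (\<Sum>x\<in>D. (u x)\<^sup>2 * deg E \<mu> x)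
    \<le> (\<Sum>x\<in>D. (u x - trans_op E \<mu> u x) * u x * deg E \<mu> x)"
proof (cases "\<exists>x\<in>D. u x \<noteq> 0")
  case True
  have dp: "0 < deg E \<mu> x" if "x \<in> D" for x
    using that D deg_pos_of_infinite[OF inf] by auto
  have pos: "0 < (\<Sum>x\<in>D. (u x)\<^sup>2 * deg E \<mu> x)"
    using True dp D(1) by (metis (no_types, lifting) less_imp_le mult_nonneg_nonneg mult_pos_pos
        sum_pos2 zero_le_power2 zero_less_power2)
  have adm: "admissible D u"
    using True supp by (auto simp: admissible_def boundary_def)
  have "lambda1_graph X E \<mu> \<le> lambda1 X E \<mu> D"
    using True D by (intro lambda1_graph_le) auto
  also have "\<dots> \<le> rayleigh D u"
    unfolding lambda1_alt
  proof (rule cInf_lower)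
    show "rayleigh D u \<in> {rayleigh D u |u. admissible D u}" using adm by blast
    show "bdd_below {rayleigh D u |u. admissible D u}"
      using rayleigh_nonneg[OF D] by (intro bdd_belowI[of _ 0]) auto
  qed
  also have "\<dots> = (\<Sum>x\<in>D. (u x - trans_op E \<mu> u x) * u x * deg E \<mu> x)
      / (\<Sum>x\<in>D. (u x)\<^sup>2 * deg E \<mu> x)"
    unfolding rayleigh_def graph_integral_def
    by (intro arg_cong2[of _ _ _ _ "(/)"] sum.cong refl) (simp add: laplacian_eq_trans_op dp)
  finally show ?thesis using pos by (simp add: pos_le_divide_eq)
\<comment> \<open>If \<open>u\<close> is zero on all of \<open>D\<close>, it is not admissible, but
  both sides are 0.\<close>
qed simp

lemma Green_partial_sum_bounds:
  fixes y N
  defines "S \<equiv> \<lambda>x. \<Sum>n<N. trans_prob_n E \<mu> n x y"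
  assumes inf: "infinite X" and gap: "0 < lambda1_graph X E \<mu>" and x: "x \<in> X" and y: "y \<in> X"
  shows "(S x)\<^sup>2 * deg E \<mu> x \<le> deg E \<mu> y / (lambda1_graph X E \<mu>)\<^sup>2"
proof -
  let ?l = "lambda1_graph X E \<mu>"
  \<comment> \<open>The points \<open>x\<close> and \<open>y\<close> are added by hand because
    \<open>S\<close> may vanish there, for instance when \<open>N\<close> is 0, while terms at both
    are extracted below.\<close>
  define D where "D = {x, y} \<union> (\<Union>n<N. {x. trans_prob_n E \<mu> n x y \<noteq> 0})"
  have D: "finite D" "D \<subseteq> X"
    using trans_prob_n_finite_support[OF y] x y by (auto simp: D_def)
  have xy: "x \<in> D" "y \<in> D" by (auto simp: D_def)
  have supp: "S z = 0" if "z \<notin> D" for z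
    unfolding S_def using that by (intro sum.neutral) (auto simp: D_def)
  have S0: "0 \<le> S z" for z
    unfolding S_def by (intro sum_nonneg trans_prob_n_nonneg)
  \<comment> \<open>Applying P shifts the index \<open>n\<close> to \<open>Suc n\<close>, so the
    difference telescopes to its two end terms. Dropping the nonnegative one at \<open>N\<close>
    leaves at most the point mass at \<open>y\<close>.\<close>
  have "S z - trans_op E \<mu> S z = trans_prob_n E \<mu> 0 z y - trans_prob_n E \<mu> N z y" for z
    unfolding S_def trans_op_sum trans_prob_n_Suc[symmetric] sum_subtractf[symmetric]
    by (rule sum_lessThan_telescope')
  then have diff: "S z - trans_op E \<mu> S z \<le> (if z = y then 1 else 0)" for z
    using trans_prob_n_nonneg[of N z y] by (simp add: trans_prob_n_0)
  have "?l * (\<Sum>z\<in>D. (S z)\<^sup>2 * deg E \<mu> z) \<le> (\<Sum>z\<in>D. (S z - trans_op E \<mu> S z) * S z * deg E \<mu> z)"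
    by (rule spectral_gap[OF inf D supp])
  also have "\<dots> \<le> (\<Sum>z\<in>D. (if z = y then 1 else 0) * S z * deg E \<mu> z)"
    by (intro sum_mono mult_right_mono diff S0 deg_nonneg)
  also have "\<dots> = (\<Sum>z\<in>D. if z = y then S y * deg E \<mu> y else 0)"
    by (intro sum.cong) auto
  also have "\<dots> = S y * deg E \<mu> y"
    using D xy by simp
  finally have energy: "?l * (\<Sum>z\<in>D. (S z)\<^sup>2 * deg E \<mu> z) \<le> S y * deg E \<mu> y" .
  \<comment> \<open>A single term of the squared norm is bounded by the whole; this is used at
    \<open>y\<close> to bound \<open>S y\<close>, then at \<open>x\<close>.\<close>
  have le: "?l * ((S z)\<^sup>2 * deg E \<mu> z) \<le> S y * deg E \<mu> y" if "z \<in> D" for z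
  proof -
    have "(S z)\<^sup>2 * deg E \<mu> z \<le> (\<Sum>z\<in>D. (S z)\<^sup>2 * deg E \<mu> z)"
      using that D(1) by (intro member_le_sum) (auto intro!: mult_nonneg_nonneg deg_nonneg)
    then show ?thesis using energy gap by (meson less_imp_le mult_left_mono order_trans)
  qed
  \<comment> \<open>At \<open>z = y\<close> the previous bound is quadratic in \<open>S y\<close> on
    the left and linear on the right, so a nonzero \<open>S y\<close> can be cancelled.\<close>
  have Sy: "?l * S y \<le> 1"
  proof (cases "S y = 0")
    case False
    then have "0 < S y * deg E \<mu> y"
      using S0[of y] deg_pos_of_infinite[OF inf y] by simp
    moreover have "(?l * S y) * (S y * deg E \<mu> y) \<le> 1 * (S y * deg E \<mu> y)"
      using le[OF xy(2)] by (simp add: power2_eq_square mult.assoc)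
    ultimately show ?thesis by (metis mult_le_cancel_right_pos)
  qed simp
  \<comment> \<open>The extra factor \<open>?l\<close> pairs with \<open>S y\<close> so that
    \<open>Sy\<close> applies; hence the square of the gap in the bound.\<close>
  have "?l * (?l * ((S x)\<^sup>2 * deg E \<mu> x)) \<le> ?l * (S y * deg E \<mu> y)"
    using le[OF xy(1)] gap by simp
  also have "\<dots> = (?l * S y) * deg E \<mu> y"
    by simp
  also have "\<dots> \<le> deg E \<mu> y"
    using mult_right_mono[OF Sy deg_nonneg[of y]] by simp
  finally show ?thesis
    using gap by (simp add: pos_le_divide_eq power2_eq_square mult_ac)
qed

lemma has_global_Green_of_lambda1_pos:
  assumes inf: "infinite X" and gap: "0 < lambda1_graph X E \<mu>"
  shows "has_global_Green X E \<mu>"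
  unfolding has_global_Green_def
proof (intro ballI)
  fix x y assume x: "x \<in> X" and y: "y \<in> X"
  \<comment> \<open>\<open>C\<close> is free of \<open>N\<close>, so \<open>sqrt C\<close> bounds
    all partial sums of the nonnegative series at once.\<close>
  define C where "C = deg E \<mu> y / (lambda1_graph X E \<mu>)\<^sup>2 / deg E \<mu> x"
  have "(\<Sum>n<N. trans_prob_n E \<mu> n x y) \<le> sqrt C" for N
    using Green_partial_sum_bounds[OF inf gap x y, of N] deg_pos_of_infinite[OF inf x]
    by (intro real_le_rsqrt) (simp only: C_def pos_le_divide_eq)
  then show "summable (\<lambda>n. trans_prob_n E \<mu> n x y)"
    by (intro summableI_nonneg_bounded trans_prob_n_nonneg)
qed

end

theorem theorem3p3:
  fixes X :: "'a set" and E :: "('a \<times> 'a) set" and \<mu> :: "'a \<Rightarrow> 'a \<Rightarrow> real"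
  assumes "weighted_graph X E \<mu>"
    and "infinite X"
    and "lambda1_graph X E \<mu> > 0"
  shows "has_global_Green X E \<mu>"
  using weighted_graph.has_global_Green_of_lambda1_pos[OF assms] .

end
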